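(* Let $M$ be a smooth manifold, $h$ a non-degenerate symmetric or skew-symmetric $(0,2)$-tensor field on $M$ and $\nabla$ an affine connection on $M$ such that $(M,h,\nabla)$ is a quasi-statistical manifold. Let $\hat J_c(X+\alpha)=-h^{-1}(\alpha)+h(X)$ and $\hat J_p(X+\alpha)=h^{-1}(\alpha)+h(X)$ on $TM\oplus T^*M$, let $\hat\nabla_{X+\alpha}(Y+\beta)=\nabla_XY+h(\nabla_X(h^{-1}(\beta)))$, and let $\hat\nabla^*$ be the dual connection of $\hat\nabla$ with respect to $\hat h$. Then $\hat J_c$ and $\hat J_p$ are $\hat\nabla$-parallel and $\hat\nabla^*$-parallel.
   Context: $\nabla$ may have torsion $T^\nabla(X,Y)=\nabla_XY-\nabla_YX-[X,Y]$ and acts on 1-forms by $(\nabla_X\beta)(Y)=X(\beta(Y))-\beta(\nabla_XY)$. $h$ also denotes the isomorphism $TM\to T^*M$, $h(X)=h(X,\cdot)$, with inverse $h^{-1}$. $(M,h,\nabla)$ is a quasi-statistical manifold if $(\nabla_Xh)(Y,Z)-(\nabla_Yh)(X,Z)+h(T^\nabla(X,Y),Z)=0$ for all $X,Y,Z$. On $TM\oplus T^*M$: $\hat h(X+\alpha,Y+\beta)=-\frac12(\alpha(Y)+\beta(X))$ if $h$ is symmetric, $\hat h(X+\alpha,Y+\beta)=-\frac12(\alpha(Y)-\beta(X))$ if $h$ is skew-symmetric; $\hat\nabla^*$ is defined by $\hat h(\tau,\hat\nabla^*_{X+\alpha}\nu)=X(\hat h(\tau,\nu))-\hat h(\hat\nabla_{X+\alpha}\tau,\nu)$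 for all sections $\tau,\nu$. An endomorphism $\hat J$ of $TM\oplus T^*M$ is $D$-parallel if $D_\sigma(\hat J\tau)=\hat J(D_\sigma\tau)$ for all sections $\sigma,\tau$. *)

theory Defs
  imports "HOL-Analysis.Analysis"
begin

section \<open>Smooth maps between vector spaces\<close>

text \<open>On an open subset of a Euclidean space, a map is \<open>C\<^sup>k\<close> iff it is \<open>k\<close> times
  differentiable with all iterated directional derivatives of order \<open>k\<close> continuous.\<close>

fun Ck_on :: "nat \<Rightarrow> 'e::euclidean_space set \<Rightarrow> ('e \<Rightarrow> 'f::real_normed_vector) \<Rightarrow> bool" where
  "Ck_on 0 S f \<longleftrightarrow> continuous_on S f"
| "Ck_on (Suc k) S f \<longleftrightarrow> (\<forall>x\<in>S. f differentiable (at x)) \<and>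
     (\<forall>v. Ck_on k S (\<lambda>x. frechet_derivative f (at x) v))"

definition smooth_on :: "'e::euclidean_space set \<Rightarrow> ('e \<Rightarrow> 'f::real_normed_vector) \<Rightarrow> bool" where
  "smooth_on S f \<longleftrightarrow> (\<forall>k. Ck_on k S f)"

section \<open>Smooth manifolds\<close>

text \<open>The manifold \<open>M\<close> is the whole type \<open>'m\<close>, whose class provides the Hausdorff and
  second countable topology; the smooth structure is given by an atlas, which need not be
  maximal. A chart is a pair of an open set and a coordinate map, whose values outside
  that set are irrelevant.\<close>

type_synonym ('m, 'e) chart = "'m set \<times> ('m \<Rightarrow> 'e)"

definition chart_inv :: "('m, 'e) chart \<Rightarrow> 'e \<Rightarrow> 'm" where
  "chart_inv c = inv_into (fst c) (snd c)"

definition chart_image :: "('m, 'e) chart \<Rightarrow> 'e set" where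
  "chart_image c = snd c ` fst c"

definition smooth_manifold ::
    "('m::{t2_space, second_countable_topology}, 'e::euclidean_space) chart set \<Rightarrow> bool" where
  "smooth_manifold A \<longleftrightarrow>
     (\<forall>c\<in>A. open (fst c) \<and> open (chart_image c) \<and>
        homeomorphism (fst c) (chart_image c) (snd c) (chart_inv c)) \<and>
     (\<Union>c\<in>A. fst c) = UNIV \<and>
     (\<forall>c\<in>A. \<forall>d\<in>A. smooth_on (snd c ` (fst c \<inter> fst d)) (snd d \<circ> chart_inv c))"

definition smooth_function :: "('m, 'e::euclidean_space) chart set \<Rightarrow> ('m \<Rightarrow> real) \<Rightarrow> bool" where
  "smooth_function A f \<longleftrightarrow> (\<forall>c\<in>A. smooth_on (chart_image c) (f \<circ> chart_inv c))"

section \<open>Tangent vectors, vector fields, 1-forms and (0,2)-tensors\<close>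

text \<open>A tangent vector at \<open>p\<close> is an equivalence class of pairs of a chart around \<open>p\<close> and a
  component vector in \<open>'e\<close>, where components in different charts are related by the derivative
  of the transition map. Each class has exactly one representative in the chart selected by
  \<open>chart_at A p\<close>, so the tangent space at \<open>p\<close> is identified with \<open>'e\<close> through
  that chart, and the cotangent space with the dual \<open>'e \<Rightarrow>\<^sub>L real\<close> (all linear functionals, as
  \<open>'e\<close> is finite-dimensional). The selected chart may vary discontinuously with the point;
  smoothness is therefore always expressed in the components with respect to a fixed chart.\<close>

definition chart_at :: "('m, 'e) chart set \<Rightarrow> 'm \<Rightarrow> ('m, 'e) chart" where
  "chart_at A p = (SOME c. c \<in> A \<and> p \<in> fst c)"

text \<open>The components in the chart \<open>c\<close> of a tangent vector at \<open>p\<close>, and conversely the tangent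
  vector at \<open>p\<close> with given components in \<open>c\<close>.\<close>

definition to_chart ::
    "('m, 'e::euclidean_space) chart set \<Rightarrow> ('m, 'e) chart \<Rightarrow> 'm \<Rightarrow> 'e \<Rightarrow> 'e" where
  "to_chart A c p =
     frechet_derivative (snd c \<circ> chart_inv (chart_at A p)) (at (snd (chart_at A p) p))"

definition from_chart ::
    "('m, 'e::euclidean_space) chart set \<Rightarrow> ('m, 'e) chart \<Rightarrow> 'm \<Rightarrow> 'e \<Rightarrow> 'e" where
  "from_chart A c p = frechet_derivative (snd (chart_at A p) \<circ> chart_inv c) (at (snd c p))"

type_synonym ('m, 'e) vfield = "'m \<Rightarrow> 'e"
type_synonym ('m, 'e) oneform = "'m \<Rightarrow> 'e \<Rightarrow>\<^sub>L real"
type_synonym ('m, 'e) tensor02 = "'m \<Rightarrow> 'e \<Rightarrow>\<^sub>L 'e \<Rightarrow>\<^sub>L real"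

definition smooth_vfield ::
    "('m, 'e::euclidean_space) chart set \<Rightarrow> ('m, 'e) vfield \<Rightarrow> bool" where
  "smooth_vfield A X \<longleftrightarrow>
     (\<forall>c\<in>A. smooth_on (chart_image c)
        (\<lambda>x. to_chart A c (chart_inv c x) (X (chart_inv c x))))"

definition smooth_oneform ::
    "('m, 'e::euclidean_space) chart set \<Rightarrow> ('m, 'e) oneform \<Rightarrow> bool" where
  "smooth_oneform A \<beta> \<longleftrightarrow>
     (\<forall>c\<in>A. \<forall>u. smooth_on (chart_image c)
        (\<lambda>x. blinfun_apply (\<beta> (chart_inv c x)) (from_chart A c (chart_inv c x) u)))"

definition smooth_tensor02 ::
    "('m, 'e::euclidean_space) chart set \<Rightarrow> ('m, 'e) tensor02 \<Rightarrow> bool" where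
  "smooth_tensor02 A h \<longleftrightarrow>
     (\<forall>c\<in>A. \<forall>u v. smooth_on (chart_image c)
        (\<lambda>x. blinfun_apply (blinfun_apply (h (chart_inv c x))
           (from_chart A c (chart_inv c x) u)) (from_chart A c (chart_inv c x) v)))"

text \<open>The function \<open>X f\<close>.\<close>

definition deriv_along ::
    "('m, 'e::euclidean_space) chart set \<Rightarrow> ('m, 'e) vfield \<Rightarrow> ('m \<Rightarrow> real) \<Rightarrow> 'm \<Rightarrow> real" where
  "deriv_along A X f p =
     frechet_derivative (f \<circ> chart_inv (chart_at A p)) (at (snd (chart_at A p) p)) (X p)"

definition lie_bracket ::
    "('m, 'e::euclidean_space) chart set \<Rightarrow> ('m, 'e) vfield \<Rightarrow> ('m, 'e) vfield \<Rightarrow> ('m, 'e) vfield"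
  where
  "lie_bracket A X Y = (THE Z. smooth_vfield A Z \<and>
     (\<forall>f. smooth_function A f \<longrightarrow> (\<forall>p. deriv_along A Z f p =
        deriv_along A X (deriv_along A Y f) p - deriv_along A Y (deriv_along A X f) p)))"

definition symmetric_tensor :: "('m, 'e::euclidean_space) tensor02 \<Rightarrow> bool" where
  "symmetric_tensor h \<longleftrightarrow>
     (\<forall>p v w. blinfun_apply (blinfun_apply (h p) v) w = blinfun_apply (blinfun_apply (h p) w) v)"

definition skew_symmetric_tensor :: "('m, 'e::euclidean_space) tensor02 \<Rightarrow> bool" where
  "skew_symmetric_tensor h \<longleftrightarrow>
     (\<forall>p v w. blinfun_apply (blinfun_apply (h p) v) w = - blinfun_apply (blinfun_apply (h p) w) v)"

definition nondegenerate_tensor :: "('m, 'e::euclidean_space) tensor02 \<Rightarrow> bool" where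
  "nondegenerate_tensor h \<longleftrightarrow>
     (\<forall>p v. (\<forall>w. blinfun_apply (blinfun_apply (h p) v) w = 0) \<longrightarrow> v = 0)"

section \<open>Affine connections and quasi-statistical manifolds\<close>

text \<open>Operators on sections are total functions of which only the values on smooth sections
  matter.\<close>

definition affine_connection ::
    "('m, 'e::euclidean_space) chart set \<Rightarrow>
     (('m, 'e) vfield \<Rightarrow> ('m, 'e) vfield \<Rightarrow> ('m, 'e) vfield) \<Rightarrow> bool" where
  "affine_connection A nab \<longleftrightarrow>
     (\<forall>X Y. smooth_vfield A X \<longrightarrow> smooth_vfield A Y \<longrightarrow> smooth_vfield A (nab X Y)) \<and>
     (\<forall>X X' Y. smooth_vfield A X \<longrightarrow> smooth_vfield A X' \<longrightarrow> smooth_vfield A Y \<longrightarrow>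
        nab (\<lambda>p. X p + X' p) Y = (\<lambda>p. nab X Y p + nab X' Y p)) \<and>
     (\<forall>f X Y. smooth_function A f \<longrightarrow> smooth_vfield A X \<longrightarrow> smooth_vfield A Y \<longrightarrow>
        nab (\<lambda>p. f p *\<^sub>R X p) Y = (\<lambda>p. f p *\<^sub>R nab X Y p)) \<and>
     (\<forall>X Y Y'. smooth_vfield A X \<longrightarrow> smooth_vfield A Y \<longrightarrow> smooth_vfield A Y' \<longrightarrow>
        nab X (\<lambda>p. Y p + Y' p) = (\<lambda>p. nab X Y p + nab X Y' p)) \<and>
     (\<forall>f X Y. smooth_function A f \<longrightarrow> smooth_vfield A X \<longrightarrow> smooth_vfield A Y \<longrightarrow>
        nab X (\<lambda>p. f p *\<^sub>R Y p) = (\<lambda>p. f p *\<^sub>R nab X Y p + deriv_along A X f p *\<^sub>R Y p))"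

definition torsion ::
    "('m, 'e::euclidean_space) chart set \<Rightarrow>
     (('m, 'e) vfield \<Rightarrow> ('m, 'e) vfield \<Rightarrow> ('m, 'e) vfield) \<Rightarrow>
     ('m, 'e) vfield \<Rightarrow> ('m, 'e) vfield \<Rightarrow> ('m, 'e) vfield" where
  "torsion A nab X Y = (\<lambda>p. nab X Y p - nab Y X p - lie_bracket A X Y p)"

text \<open>\<open>tensor_app h X Y\<close> is the function \<open>h(X, Y)\<close>.\<close>

definition tensor_app ::
    "('m, 'e::euclidean_space) tensor02 \<Rightarrow> ('m, 'e) vfield \<Rightarrow> ('m, 'e) vfield \<Rightarrow> 'm \<Rightarrow> real" where
  "tensor_app h X Y = (\<lambda>p. blinfun_apply (blinfun_apply (h p) (X p)) (Y p))"

text \<open>\<open>cov_deriv A nab h X Y Z\<close> is the function \<open>(\<nabla>\<^sub>X h)(Y, Z)\<close>.\<close>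

definition cov_deriv ::
    "('m, 'e::euclidean_space) chart set \<Rightarrow>
     (('m, 'e) vfield \<Rightarrow> ('m, 'e) vfield \<Rightarrow> ('m, 'e) vfield) \<Rightarrow> ('m, 'e) tensor02 \<Rightarrow>
     ('m, 'e) vfield \<Rightarrow> ('m, 'e) vfield \<Rightarrow> ('m, 'e) vfield \<Rightarrow> 'm \<Rightarrow> real" where
  "cov_deriv A nab h X Y Z = (\<lambda>p. deriv_along A X (tensor_app h Y Z) p
     - tensor_app h (nab X Y) Z p - tensor_app h Y (nab X Z) p)"

definition quasi_statistical ::
    "('m, 'e::euclidean_space) chart set \<Rightarrow> ('m, 'e) tensor02 \<Rightarrow>
     (('m, 'e) vfield \<Rightarrow> ('m, 'e) vfield \<Rightarrow> ('m, 'e) vfield) \<Rightarrow> bool" where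
  "quasi_statistical A h nab \<longleftrightarrow>
     (\<forall>X Y Z. smooth_vfield A X \<longrightarrow> smooth_vfield A Y \<longrightarrow> smooth_vfield A Z \<longrightarrow>
        (\<forall>p. cov_deriv A nab h X Y Z p - cov_deriv A nab h Y X Z p
             + tensor_app h (torsion A nab X Y) Z p = 0))"

section \<open>The generalized tangent bundle\<close>

text \<open>The fibre of \<open>TM \<oplus> T\<^sup>*M\<close> at \<open>p\<close> consists of the pairs \<open>(v, a)\<close>, standing for \<open>v + a\<close>.\<close>

type_synonym 'e gfibre = "'e \<times> ('e \<Rightarrow>\<^sub>L real)"
type_synonym ('m, 'e) gsection = "'m \<Rightarrow> 'e gfibre"

definition smooth_gsection ::
    "('m, 'e::euclidean_space) chart set \<Rightarrow> ('m, 'e) gsection \<Rightarrow> bool" where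
  "smooth_gsection A \<tau> \<longleftrightarrow> smooth_vfield A (fst \<circ> \<tau>) \<and> smooth_oneform A (snd \<circ> \<tau>)"

definition h_inv :: "('m, 'e::euclidean_space) tensor02 \<Rightarrow> 'm \<Rightarrow> ('e \<Rightarrow>\<^sub>L real) \<Rightarrow> 'e" where
  "h_inv h p = inv (blinfun_apply (h p))"

text \<open>Meant for \<open>h\<close> symmetric or skew-symmetric, so the second branch is the skew-symmetric case.
  The cases exclude each other, as a non-degenerate \<open>h\<close> is not zero.\<close>

definition hat_h :: "('m, 'e::euclidean_space) tensor02 \<Rightarrow> 'm \<Rightarrow> 'e gfibre \<Rightarrow> 'e gfibre \<Rightarrow> real"
  where
  "hat_h h p \<sigma> \<tau> =
     (if symmetric_tensor h
      then - (1/2) * (blinfun_apply (snd \<sigma>) (fst \<tau>) + blinfun_apply (snd \<tau>) (fst \<sigma>))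
      else - (1/2) * (blinfun_apply (snd \<sigma>) (fst \<tau>) - blinfun_apply (snd \<tau>) (fst \<sigma>)))"

definition J_c :: "('m, 'e::euclidean_space) tensor02 \<Rightarrow> 'm \<Rightarrow> 'e gfibre \<Rightarrow> 'e gfibre" where
  "J_c h p \<tau> = (- h_inv h p (snd \<tau>), blinfun_apply (h p) (fst \<tau>))"

definition J_p :: "('m, 'e::euclidean_space) tensor02 \<Rightarrow> 'm \<Rightarrow> 'e gfibre \<Rightarrow> 'e gfibre" where
  "J_p h p \<tau> = (h_inv h p (snd \<tau>), blinfun_apply (h p) (fst \<tau>))"

definition hat_nabla ::
    "('m, 'e::euclidean_space) tensor02 \<Rightarrow>
     (('m, 'e) vfield \<Rightarrow> ('m, 'e) vfield \<Rightarrow> ('m, 'e) vfield) \<Rightarrow>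
     ('m, 'e) gsection \<Rightarrow> ('m, 'e) gsection \<Rightarrow> ('m, 'e) gsection" where
  "hat_nabla h nab \<sigma> \<tau> =
     (\<lambda>p. (nab (fst \<circ> \<sigma>) (fst \<circ> \<tau>) p,
           blinfun_apply (h p) (nab (fst \<circ> \<sigma>) (\<lambda>q. h_inv h q (snd (\<tau> q))) p)))"

text \<open>\<open>D'\<close> is the dual of \<open>D\<close> with respect to the bilinear form \<open>g\<close> on \<open>TM \<oplus> T\<^sup>*M\<close>. For
  non-degenerate \<open>g\<close> the defining equation determines \<open>D'\<close> on smooth sections.\<close>

definition dual_connection ::
    "('m, 'e::euclidean_space) chart set \<Rightarrow> ('m \<Rightarrow> 'e gfibre \<Rightarrow> 'e gfibre \<Rightarrow> real) \<Rightarrow>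
     (('m, 'e) gsection \<Rightarrow> ('m, 'e) gsection \<Rightarrow> ('m, 'e) gsection) \<Rightarrow>
     (('m, 'e) gsection \<Rightarrow> ('m, 'e) gsection \<Rightarrow> ('m, 'e) gsection) \<Rightarrow> bool" where
  "dual_connection A g D D' \<longleftrightarrow>
     (\<forall>\<sigma> \<nu>. smooth_gsection A \<sigma> \<longrightarrow> smooth_gsection A \<nu> \<longrightarrow>
        smooth_gsection A (D' \<sigma> \<nu>) \<and>
        (\<forall>\<tau>. smooth_gsection A \<tau> \<longrightarrow>
           (\<forall>p. g p (\<tau> p) (D' \<sigma> \<nu> p) =
              deriv_along A (fst \<circ> \<sigma>) (\<lambda>q. g q (\<tau> q) (\<nu> q)) p - g p (D \<sigma> \<tau> p) (\<nu> p))))"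

definition parallel ::
    "('m, 'e::euclidean_space) chart set \<Rightarrow>
     (('m, 'e) gsection \<Rightarrow> ('m, 'e) gsection \<Rightarrow> ('m, 'e) gsection) \<Rightarrow>
     ('m \<Rightarrow> 'e gfibre \<Rightarrow> 'e gfibre) \<Rightarrow> bool" where
  "parallel A D J \<longleftrightarrow>
     (\<forall>\<sigma> \<tau>. smooth_gsection A \<sigma> \<longrightarrow> smooth_gsection A \<tau> \<longrightarrow>
        D \<sigma> (\<lambda>p. J p (\<tau> p)) = (\<lambda>p. J p (D \<sigma> \<tau> p)))"

end

theory Submission
  imports Defs
begin

text \<open>Both structures have the form \<open>J(X + \<alpha>) = s h\<^sup>-\<^sup>1(\<alpha>) + h(X)\<close> with a constant \<open>s\<close>. The
  connection \<open>\<nabla>\<close> on \<open>TM\<close> is carried to \<open>T\<^sup>*M\<close> by \<open>h\<close>, so \<open>J\<close> commutes with the lifted connection.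
  Moreover \<open>J\<close> is self-adjoint for the pairing on \<open>TM \<oplus> T\<^sup>*M\<close>, so the defining equation of the dual
  connection, applied to \<open>(\<tau>, J \<nu>)\<close> and to \<open>(J \<tau>, \<nu>)\<close>, shows that \<open>J\<close> also commutes with the dual
  connection after pairing with an arbitrary smooth section \<open>\<tau>\<close>. What remains is analytic: \<open>h\<^sup>-\<^sup>1\<close>
  preserves smoothness, because the solution of a linear system depends smoothly on its data, and
  smooth sections through each point separate the vectors of the fibre, by bump functions.\<close>

section \<open>Calculus of smooth maps\<close>

text \<open>Openness of \<open>S\<close> makes the derivatives agree as well, so the induction can
  pass to them. Coordinate expressions coincide only inside chart images, which is why this rule is
  needed throughout.\<close>

lemma Ck_on_cong:
  assumes "open S" "\<And>x. x \<in> S \<Longrightarrow> f x = g x" "Ck_on k S f"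
  shows "Ck_on k S g"
  using assms(2,3)
proof (induction k arbitrary: f g)
  case 0
  then show ?case by (auto cong: continuous_on_cong)
next
  case (Suc k)
  have der: "(g has_derivative frechet_derivative f (at x)) (at x)" if "x \<in> S" for x
    using Suc.prems that assms(1)
    by (auto intro: has_derivative_transform_within_open simp: frechet_derivative_works)
  then have "frechet_derivative g (at x) = frechet_derivative f (at x)" if "x \<in> S" for x
    using that frechet_derivative_at by metis
  then have "Ck_on k S (\<lambda>x. frechet_derivative g (at x) v)" for v
    using Suc.IH[of "\<lambda>x. frechet_derivative f (at x) v"] Suc.prems by simp
  then show ?case
    using der by (auto simp: differentiable_def)
qed

text \<open>Lets each differentiation rule supply its explicit derivative \<open>f'\<close>, so that
  \<open>frechet_derivative\<close> never has to be evaluated.\<close>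

lemma Ck_on_SucI:
  assumes "open S" "\<And>x. x \<in> S \<Longrightarrow> (f has_derivative f' x) (at x)"
    and "\<And>v. Ck_on k S (\<lambda>x. f' x v)"
  shows "Ck_on (Suc k) S f"
proof -
  have "f' x = frechet_derivative f (at x)" if "x \<in> S" for x
    using assms(2)[OF that] frechet_derivative_at by blast
  then have "Ck_on k S (\<lambda>x. frechet_derivative f (at x) v)" for v
    using Ck_on_cong[OF assms(1) _ assms(3)] by simp
  then show ?thesis
    using assms(2) by (auto simp: differentiable_def)
qed

lemma Ck_on_has_derivative:
  "Ck_on (Suc k) S f \<Longrightarrow> x \<in> S \<Longrightarrow> (f has_derivative frechet_derivative f (at x)) (at x)"
  by (simp add: frechet_derivative_works)

lemma Ck_on_Suc_lower: "Ck_on (Suc k) S f \<Longrightarrow> Ck_on k S f"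
proof (induction k arbitrary: f)
  case 0
  then show ?case
    by (auto intro!: differentiable_imp_continuous_on differentiable_at_imp_differentiable_on)
next
  case (Suc k)
  then show ?case by simp
qed

lemma Ck_on_subset: "Ck_on k T f \<Longrightarrow> S \<subseteq> T \<Longrightarrow> Ck_on k S f"
  by (induction k arbitrary: f) (auto intro: continuous_on_subset)

lemma Ck_on_local:
  assumes "\<And>x. x \<in> S \<Longrightarrow> \<exists>U. open U \<and> x \<in> U \<and> Ck_on k U f"
  shows "Ck_on k S f"
  using assms
proof (induction k arbitrary: f)
  case 0
  have "continuous (at x within S) f" if "x \<in> S" for x
    using 0[OF that]
    by (auto simp: continuous_on_eq_continuous_at intro: continuous_at_imp_continuous_at_within)
  then show ?case by (simp add: continuous_on_eq_continuous_within)
next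
  case (Suc k)
  have "f differentiable (at x)" if "x \<in> S" for x
    using Suc.prems[OF that] by auto
  moreover have "Ck_on k S (\<lambda>x. frechet_derivative f (at x) v)" for v
    by (rule Suc.IH) (use Suc.prems in fastforce)
  ultimately show ?case by simp
qed

section \<open>Closure of C^k maps under linear and bilinear operations\<close>

lemma Ck_on_const: "Ck_on k S (\<lambda>x. c)"
  by (induction k arbitrary: c) (auto simp: frechet_derivative_const)

lemma Ck_on_bounded_linear:
  assumes "open S" "bounded_linear L" "Ck_on k S f"
  shows "Ck_on k S (\<lambda>x. L (f x))"
  using assms(3)
proof (induction k arbitrary: f)
  case 0
  then show ?case
    using assms(2) by (simp add: bounded_linear.continuous_on)
next
  case (Suc k)
  show ?case
    by (rule Ck_on_SucI[OF assms(1)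
          bounded_linear.has_derivative[OF assms(2) Ck_on_has_derivative[OF Suc.prems]]])
      (use Suc in auto)
qed

lemma Ck_on_add:
  assumes "open S" "Ck_on k S f" "Ck_on k S g"
  shows "Ck_on k S (\<lambda>x. f x + g x)"
  using assms(2,3)
proof (induction k arbitrary: f g)
  case 0
  then show ?case by (simp add: continuous_on_add)
next
  case (Suc k)
  show ?case
    by (rule Ck_on_SucI[OF assms(1) has_derivative_add[OF
            Ck_on_has_derivative[OF Suc.prems(1)] Ck_on_has_derivative[OF Suc.prems(2)]]])
      (use Suc in auto)
qed

lemma Ck_on_sum:
  assumes "open S" "\<And>i. i \<in> I \<Longrightarrow> Ck_on k S (f i)"
  shows "Ck_on k S (\<lambda>x. \<Sum>i\<in>I. f i x)"
  using assms(2)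
  by (induction I rule: infinite_finite_induct) (auto intro: Ck_on_const Ck_on_add[OF assms(1)])

text \<open>The product rule pairs each map with the derivative of the other, so the induction also
  needs the undifferentiated maps at the lower order.\<close>

lemma Ck_on_bounded_bilinear:
  assumes "open S" "bounded_bilinear B" "Ck_on k S f" "Ck_on k S g"
  shows "Ck_on k S (\<lambda>x. B (f x) (g x))"
  using assms(3,4)
proof (induction k arbitrary: f g)
  case 0
  then show ?case
    using assms(2) by (simp add: bounded_bilinear.continuous_on)
next
  case (Suc k)
  note lower = Suc.prems[THEN Ck_on_Suc_lower]
  show ?case
    by (rule Ck_on_SucI[OF assms(1) bounded_bilinear.FDERIV[OF assms(2)
            Ck_on_has_derivative[OF Suc.prems(1)] Ck_on_has_derivative[OF Suc.prems(2)]]])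
      (use Suc lower in \<open>auto intro!: Ck_on_add[OF assms(1)]\<close>)
qed

section \<open>Parametrised linear maps, composition, and linear systems\<close>

lemma linear_basis_sum:
  fixes L :: "'e::euclidean_space \<Rightarrow> 'f::real_normed_vector"
  assumes "linear L"
  shows "L v = (\<Sum>b\<in>Basis. (v \<bullet> b) *\<^sub>R L b)"
proof -
  have "L v = L (\<Sum>b\<in>Basis. (v \<bullet> b) *\<^sub>R b)"
    by (simp add: euclidean_representation)
  then show ?thesis
    by (simp add: linear_sum[OF assms] linear_scale[OF assms])
qed

text \<open>Expanding \<open>z x\<close> in the standard basis leaves a finite sum of products, so
  regularity of \<open>H x v\<close> for each fixed \<open>v\<close> is enough to insert a moving
  vector. Smoothness of tensors is given in exactly this form.\<close>

lemma Ck_on_linear_family: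
  fixes H :: "'d::euclidean_space \<Rightarrow> 'e::euclidean_space \<Rightarrow> 'f::real_normed_vector"
  assumes "open S" "\<And>x. x \<in> S \<Longrightarrow> linear (H x)"
    and "\<And>v. Ck_on k S (\<lambda>x. H x v)" "Ck_on k S z"
  shows "Ck_on k S (\<lambda>x. H x (z x))"
proof -
  have "Ck_on k S (\<lambda>x. \<Sum>b\<in>Basis. (z x \<bullet> b) *\<^sub>R H x b)"
    by (intro Ck_on_sum Ck_on_bounded_bilinear[OF _ bounded_bilinear_scaleR] assms
        Ck_on_bounded_linear[OF _ bounded_linear_inner_left])
  then show ?thesis
    by (rule Ck_on_cong[OF assms(1), rotated]) (metis linear_basis_sum assms(2))
qed

text \<open>The chain rule applies the linear maps \<open>frechet_derivative g (at (f x))\<close> to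
  a moving vector. For a fixed vector this is again a composition with \<open>f\<close>, hence the
  induction over varying \<open>g\<close>; \<open>Ck_on_linear_family\<close> then inserts the
  derivative of \<open>f\<close>.\<close>

lemma Ck_on_compose:
  fixes g :: "'d::euclidean_space \<Rightarrow> 'f::real_normed_vector"
    and f :: "'e::euclidean_space \<Rightarrow> 'd"
  assumes "open S" "f ` S \<subseteq> T" "Ck_on k T g" "Ck_on k S f"
  shows "Ck_on k S (\<lambda>x. g (f x))"
  using assms(3,4)
proof (induction k arbitrary: g)
  case 0
  then show ?case
    using assms(2) by (auto intro: continuous_on_compose2)
next
  case (Suc k)
  have g': "(g has_derivative frechet_derivative g (at (f x))) (at (f x))" if "x \<in> S" for x
    using Ck_on_has_derivative[OF Suc.prems(1)] that assms(2) by blast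
  have "Ck_on k S f"
    using Suc.prems(2) by (rule Ck_on_Suc_lower)
  show ?case
  proof (rule Ck_on_SucI[OF assms(1)])
    show "((\<lambda>x. g (f x)) has_derivative
        (\<lambda>v. frechet_derivative g (at (f x)) (frechet_derivative f (at x) v))) (at x)"
      if "x \<in> S" for x
      using diff_chain_at[OF Ck_on_has_derivative[OF Suc.prems(2) that] g'[OF that]]
      by (simp add: o_def)
    show "Ck_on k S (\<lambda>x. frechet_derivative g (at (f x)) (frechet_derivative f (at x) v))" for v
      by (rule Ck_on_linear_family[OF assms(1)])
        (use g' Suc \<open>Ck_on k S f\<close> in \<open>auto intro: has_derivative_linear\<close>)
  qed
qed

text \<open>Injectivity survives small perturbations: \<open>H x0\<close> has a lower bound
  \<open>B\<close>, and half of it remains where \<open>H x\<close> is close to \<open>H x0\<close>.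
  The constant is uniform in \<open>v\<close> and near \<open>x0\<close>, so it acts as a local
  bound on the inverses.\<close>

lemma linear_family_bounded_below:
  fixes H :: "'d::euclidean_space \<Rightarrow> 'e::euclidean_space \<Rightarrow> 'e"
  assumes "open S" "x0 \<in> S" "\<And>x. x \<in> S \<Longrightarrow> linear (H x)" "inj (H x0)"
    and "\<And>v. continuous_on S (\<lambda>x. H x v)"
  obtains C where "C > 0" "\<forall>\<^sub>F x in at x0. x \<in> S \<and> (\<forall>v. norm v \<le> C * norm (H x v))"
proof -
  obtain B where B: "B > 0" "\<And>v. B * norm v \<le> norm (H x0 v)"
    using linear_inj_bounded_below_pos[OF assms(3)[OF assms(2)] assms(4)] by metis
  \<comment> \<open>\<open>g x\<close> dominates the operator norm of \<open>H x - H x0\<close>, yet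
    its continuity needs only finitely many fixed vectors.\<close>
  define g where "g x = (\<Sum>b\<in>Basis. norm (H x b - H x0 b))" for x
  have "continuous_on S g"
    unfolding g_def by (intro continuous_intros assms)
  then have "(g \<longlongrightarrow> g x0) (at x0)"
    using assms(1,2) by (simp add: continuous_on_eq_continuous_at isCont_def)
  then have "\<forall>\<^sub>F x in at x0. g x < B / 2"
    by (rule order_tendstoD(2)) (use B(1) in \<open>simp add: g_def\<close>)
  moreover have "\<forall>\<^sub>F x in at x0. x \<in> S"
    using assms(1,2) by (simp add: eventually_at_in_open')
  ultimately have "\<forall>\<^sub>F x in at x0. x \<in> S \<and> (\<forall>v. norm v \<le> (2 / B) * norm (H x v))"
  proof eventually_elim
    case (elim x)
    have "norm v \<le> (2 / B) * norm (H x v)" for v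
    proof -
      have "linear (\<lambda>v. H x v - H x0 v)"
        using assms(2,3) elim(2) by (intro linear_compose_sub)
      then have "norm (H x v - H x0 v) = norm (\<Sum>b\<in>Basis. (v \<bullet> b) *\<^sub>R (H x b - H x0 b))"
        by (subst linear_basis_sum) auto
      also have "\<dots> \<le> (\<Sum>b\<in>Basis. norm v * norm (H x b - H x0 b))"
        by (rule sum_norm_le) (auto intro!: mult_right_mono Basis_le_norm)
      also have "\<dots> = norm v * g x"
        by (simp add: g_def sum_distrib_left)
      also have "\<dots> \<le> norm v * (B / 2)"
        using elim(1) by (intro mult_left_mono) auto
      finally have "norm (H x v - H x0 v) \<le> norm v * (B / 2)" .
      moreover have "norm (H x0 v) \<le> norm (H x v) + norm (H x v - H x0 v)"
        using norm_triangle_sub[of "H x0 v" "H x v"] by (simp add: norm_minus_commute)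
      ultimately have "B * norm v / 2 \<le> norm (H x v)"
        using B(2)[of v] by (simp add: algebra_simps)
      then show ?thesis
        using B(1) by (simp add: field_simps)
    qed
    then show ?case using elim by blast
  qed
  then show thesis
    using that[of "2 / B"] B(1) by simp
qed

text \<open>By linearity \<open>H x (z x - z x0)\<close> equals \<open>F x\<close>, which tends to 0
  at \<open>x0\<close>; the uniform lower bound carries this over to
  \<open>z x - z x0\<close>.\<close>

lemma linear_family_solution_continuous:
  fixes H :: "'d::euclidean_space \<Rightarrow> 'e::euclidean_space \<Rightarrow> 'e"
  assumes "open S" "\<And>x. x \<in> S \<Longrightarrow> linear (H x)" "\<And>x. x \<in> S \<Longrightarrow> inj (H x)"
    and "\<And>v. continuous_on S (\<lambda>x. H x v)"
    and "continuous_on S (\<lambda>x. H x (z x))"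
  shows "continuous_on S z"
proof -
  have "(z \<longlongrightarrow> z x0) (at x0)" if x0: "x0 \<in> S" for x0
  proof -
    obtain C where C: "C > 0" "\<forall>\<^sub>F x in at x0. x \<in> S \<and> (\<forall>v. norm v \<le> C * norm (H x v))"
      using linear_family_bounded_below[OF assms(1) x0 assms(2) assms(3)[OF x0] assms(4)]
      by blast
    define F where "F x = H x (z x) - H x (z x0)" for x
    have "continuous_on S F"
      unfolding F_def by (intro continuous_intros assms)
    then have "(F \<longlongrightarrow> F x0) (at x0)"
      using assms(1) x0 by (simp add: continuous_on_eq_continuous_at isCont_def)
    then have "(F \<longlongrightarrow> 0) (at x0)"
      by (simp add: F_def)
    moreover have "\<forall>\<^sub>F x in at x0. norm (z x - z x0) \<le> norm (F x) * C"
      using C(2)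
    proof eventually_elim
      case (elim x)
      then have "H x (z x - z x0) = F x"
        using assms(2)[of x] by (simp add: F_def linear_diff)
      then show ?case
        using elim by (metis mult.commute)
    qed
    ultimately have "((\<lambda>x. z x - z x0) \<longlongrightarrow> 0) (at x0)"
      by (rule tendsto_0_le)
    then show ?thesis
      by (simp add: LIM_zero_iff)
  qed
  then show ?thesis
    using assms(1) by (simp add: continuous_on_eq_continuous_at isCont_def)
qed

text \<open>The point is that \<open>F x = \<beta> x - H x z\<^sub>0 - H x (L (x - x\<^sub>0))\<close> and
  \<open>H x (z x - z\<^sub>0 - L (x - x\<^sub>0))\<close> agree, while \<open>H x\<close> is bounded below uniformly near \<open>x\<^sub>0\<close>.\<close>

lemma linear_family_solution_has_derivative:
  fixes H :: "'d::euclidean_space \<Rightarrow> 'e::euclidean_space \<Rightarrow> 'e"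
  assumes "open S" "x0 \<in> S" "\<And>x. x \<in> S \<Longrightarrow> linear (H x)" "inj (H x0)"
    and cont: "\<And>v. continuous_on S (\<lambda>x. H x v)"
    and H': "\<And>v. ((\<lambda>x. H x v) has_derivative H' v) (at x0)"
    and \<beta>': "((\<lambda>x. H x (z x)) has_derivative \<beta>') (at x0)"
  shows "(z has_derivative (\<lambda>v. inv (H x0) (\<beta>' v - H' (z x0) v))) (at x0)"
proof -
  have lin0: "linear (H x0)" using assms(2,3) by blast
  then have bij: "bij (H x0)"
    using assms(4) linear_injective_imp_surjective by (auto simp: bij_def)
  \<comment> \<open>Formally differentiating \<open>H x (z x)\<close> gives
    \<open>H x0 (L v) + H' (z x0) v = \<beta>' v\<close>; \<open>L\<close> is the solution of this
    equation.\<close>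
  define L where "L = (\<lambda>v. inv (H x0) (\<beta>' v - H' (z x0) v))"
  have HL: "H x0 (L v) = \<beta>' v - H' (z x0) v" for v
    using bij by (simp add: L_def bij_is_surj surj_f_inv_f)
  have "linear (\<lambda>v. \<beta>' v - H' (z x0) v)"
    using \<beta>' H' by (intro linear_compose_sub has_derivative_linear)
  moreover have "linear (inv (H x0))"
  proof -
    obtain g where g: "linear g" "\<forall>x. g (H x0 x) = x" "\<forall>x. H x0 (g x) = x"
      using linear_injective_isomorphism[OF lin0 assms(4)] by blast
    then have "inv (H x0) = g"
      by (intro inv_equality) auto
    then show ?thesis using g(1) by simp
  qed
  ultimately have linL: "linear L"
    unfolding L_def using linear_compose[unfolded o_def] by blast
  then have bl: "bounded_linear L"
    by (simp add: linear_conv_bounded_linear)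
  define F where "F x = H x (z x) - H x (z x0) - H x (L (x - x0))" for x
  \<comment> \<open>Product rule in coordinates. Since \<open>L 0 = 0\<close>, the terms that
    differentiate \<open>H\<close> drop out at \<open>x0\<close>.\<close>
  have Leq: "((\<lambda>x. \<Sum>b\<in>Basis. (L (x - x0) \<bullet> b) *\<^sub>R H x b) has_derivative
      (\<lambda>v. \<Sum>b\<in>Basis. (L (x0 - x0) \<bullet> b) *\<^sub>R H' b v + (L (v - 0) \<bullet> b) *\<^sub>R H x0 b)) (at x0)"
    by (intro derivative_intros H' bounded_linear.has_derivative[OF bl])
  have "((\<lambda>x. H x (L (x - x0))) has_derivative (\<lambda>v. H x0 (L v))) (at x0)"
  proof (rule has_derivative_transform_within_open[OF _ assms(1,2)])
    show "((\<lambda>x. \<Sum>b\<in>Basis. (L (x - x0) \<bullet> b) *\<^sub>R H x b) has_derivative (\<lambda>v. H x0 (L v))) (at x0)"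
      using Leq by (simp add: linear_0[OF linL] linear_basis_sum[OF lin0, symmetric])
    show "(\<Sum>b\<in>Basis. (L (x - x0) \<bullet> b) *\<^sub>R H x b) = H x (L (x - x0))" if "x \<in> S" for x
      by (rule linear_basis_sum[OF assms(3)[OF that], symmetric])
  qed
  then have "(F has_derivative (\<lambda>v. \<beta>' v - H' (z x0) v - H x0 (L v))) (at x0)"
    unfolding F_def by (intro derivative_intros H' \<beta>')
  then have F': "(F has_derivative (\<lambda>v. 0)) (at x0)"
    by (simp add: HL)
  have F0: "F x0 = 0"
    by (simp add: F_def linear_0[OF linL] linear_0[OF lin0])
  obtain C where C: "C > 0" "\<forall>\<^sub>F x in at x0. x \<in> S \<and> (\<forall>v. norm v \<le> C * norm (H x v))"
    using linear_family_bounded_below[OF assms(1,2,3,4) cont] by blast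
  have "((\<lambda>x. (1 / norm (x - x0)) *\<^sub>R F x) \<longlongrightarrow> 0) (at x0)"
    using F' F0 by (simp add: has_derivative_at2)
  moreover have "\<forall>\<^sub>F x in at x0. norm ((1 / norm (x - x0)) *\<^sub>R (z x - (z x0 + L (x - x0))))
      \<le> norm ((1 / norm (x - x0)) *\<^sub>R F x) * C"
    using C(2)
  proof eventually_elim
    case (elim x)
    have "H x (z x - (z x0 + L (x - x0))) = F x"
      using assms(3)[of x] elim by (simp add: F_def linear_diff linear_add)
    then have "norm (z x - (z x0 + L (x - x0))) \<le> C * norm (F x)"
      using elim by metis
    then show ?case
      by (simp add: divide_right_mono mult.commute)
  qed
  ultimately have "((\<lambda>x. (1 / norm (x - x0)) *\<^sub>R (z x - (z x0 + L (x - x0)))) \<longlongrightarrow> 0) (at x0)"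
    by (rule tendsto_0_le)
  then show ?thesis
    using bl unfolding L_def[symmetric] by (simp add: has_derivative_at2)
qed

text \<open>The derivative of a solution solves a system with the same maps \<open>H x\<close>,
  whose right-hand side involves only first derivatives of the data and \<open>z\<close> itself. The
  induction hypothesis is used twice: for \<open>z\<close>, which makes this right-hand side C^k,
  and then for the derivative of \<open>z\<close>.\<close>

lemma Ck_on_linear_family_solution:
  fixes H :: "'d::euclidean_space \<Rightarrow> 'e::euclidean_space \<Rightarrow> 'e"
  assumes "open S" "\<And>x. x \<in> S \<Longrightarrow> linear (H x)" "\<And>x. x \<in> S \<Longrightarrow> inj (H x)"
    and "\<And>v. Ck_on k S (\<lambda>x. H x v)" "Ck_on k S (\<lambda>x. H x (z x))"
  shows "Ck_on k S z"
  using assms(4,5)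
proof (induction k arbitrary: z)
  case 0
  then show ?case
    using linear_family_solution_continuous[OF assms(1,2,3)] by simp
next
  case (Suc k)
  let ?H' = "\<lambda>x w v. frechet_derivative (\<lambda>x. H x w) (at x) v"
  let ?b' = "\<lambda>x v. frechet_derivative (\<lambda>x. H x (z x)) (at x) v"
  have lower: "Ck_on k S (\<lambda>x. H x v)" for v
    by (rule Ck_on_Suc_lower) (rule Suc.prems)
  have cont: "continuous_on S (\<lambda>x. H x v)" for v
    using Suc.prems(1)[of v]
    by (auto intro!: differentiable_imp_continuous_on differentiable_at_imp_differentiable_on)
  note dH = Ck_on_has_derivative[OF Suc.prems(1)]
  have "Ck_on k S z"
    using Suc.IH lower Ck_on_Suc_lower[OF Suc.prems(2)] by blast
  \<comment> \<open>Differentiation in the base point preserves linearity in \<open>w\<close>, so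
    the derivatives of \<open>H\<close> can be evaluated at the moving vector
    \<open>z x\<close>.\<close>
  have lin': "linear (\<lambda>w. ?H' x w v)" if "x \<in> S" for x v
  proof (rule linearI)
    fix w1 w2
    have "((\<lambda>y. H y (w1 + w2)) has_derivative (\<lambda>v. ?H' x w1 v + ?H' x w2 v)) (at x)"
      by (rule has_derivative_transform_within_open[OF has_derivative_add[OF dH[OF that] dH[OF that]]
            assms(1) that])
        (simp add: assms(2) linear_add)
    from fun_cong[OF frechet_derivative_at[OF this], of v]
    show "?H' x (w1 + w2) v = ?H' x w1 v + ?H' x w2 v" ..
  next
    fix r w
    have "((\<lambda>y. H y (r *\<^sub>R w)) has_derivative (\<lambda>v. r *\<^sub>R ?H' x w v)) (at x)"
      by (rule has_derivative_transform_within_open[OF has_derivative_scaleR_right[OF dH[OF that]]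
            assms(1) that])
        (simp add: assms(2) linear_scale)
    from fun_cong[OF frechet_derivative_at[OF this], of v]
    show "?H' x (r *\<^sub>R w) v = r *\<^sub>R ?H' x w v" ..
  qed
  show ?case
  proof (rule Ck_on_SucI[OF assms(1)])
    show "(z has_derivative (\<lambda>v. inv (H x) (?b' x v - ?H' x (z x) v))) (at x)" if "x \<in> S" for x
      using linear_family_solution_has_derivative[OF assms(1) that assms(2) assms(3)[OF that]
          cont dH[OF that] Ck_on_has_derivative[OF Suc.prems(2) that]] .
    show "Ck_on k S (\<lambda>x. inv (H x) (?b' x v - ?H' x (z x) v))" for v
    proof (rule Suc.IH[OF lower])
      have b': "Ck_on k S (\<lambda>x. ?b' x v)"
        using Suc.prems(2) by simp
      have H': "Ck_on k S (\<lambda>x. ?H' x w v)" for w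
        using Suc.prems(1)[of w] by simp
      have "Ck_on k S (\<lambda>x. ?H' x (z x) v)"
        by (rule Ck_on_linear_family[where H = "\<lambda>x w. ?H' x w v", OF assms(1) lin' H'])
          (simp_all add: \<open>Ck_on k S z\<close>)
      then have "Ck_on k S (\<lambda>x. - ?H' x (z x) v)"
        by (rule Ck_on_bounded_linear[OF assms(1) bounded_linear_minus[OF bounded_linear_ident]])
      with b' have rhs: "Ck_on k S (\<lambda>x. ?b' x v + - ?H' x (z x) v)"
        by (rule Ck_on_add[OF assms(1)])
      have "H x (inv (H x) w) = w" if "x \<in> S" for x w
        using linear_injective_imp_surjective[OF assms(2,3)[OF that]] by (simp add: surj_f_inv_f)
      then show "Ck_on k S (\<lambda>x. H x (inv (H x) (?b' x v - ?H' x (z x) v)))"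
        by (intro Ck_on_cong[OF assms(1) _ rhs]) simp
    qed
  qed
qed

section \<open>Passage from finite order to smooth maps\<close>

lemma smooth_on_linear_family:
  fixes H :: "'d::euclidean_space \<Rightarrow> 'e::euclidean_space \<Rightarrow> 'f::real_normed_vector"
  assumes "open S" "\<And>x. x \<in> S \<Longrightarrow> linear (H x)"
    and "\<And>v. smooth_on S (\<lambda>x. H x v)" "smooth_on S z"
  shows "smooth_on S (\<lambda>x. H x (z x))"
  using assms Ck_on_linear_family[of S H] by (simp add: smooth_on_def)

lemma smooth_on_linear_family_solution:
  fixes H :: "'d::euclidean_space \<Rightarrow> 'e::euclidean_space \<Rightarrow> 'e"
  assumes "open S" "\<And>x. x \<in> S \<Longrightarrow> linear (H x)" "\<And>x. x \<in> S \<Longrightarrow> inj (H x)"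
    and "\<And>v. smooth_on S (\<lambda>x. H x v)" "smooth_on S (\<lambda>x. H x (z x))"
  shows "smooth_on S z"
  using assms Ck_on_linear_family_solution[of S H] by (simp add: smooth_on_def)

lemma smooth_on_local:
  assumes "\<And>x. x \<in> S \<Longrightarrow> \<exists>U. open U \<and> x \<in> U \<and> smooth_on U f"
  shows "smooth_on S f"
  unfolding smooth_on_def using assms by (fastforce simp: smooth_on_def intro: Ck_on_local)

lemma smooth_on_cong:
  assumes "open S" "\<And>x. x \<in> S \<Longrightarrow> f x = g x" "smooth_on S f"
  shows "smooth_on S g"
  using assms Ck_on_cong[of S f g] by (simp add: smooth_on_def)

lemma smooth_on_const: "smooth_on S (\<lambda>x. c)"
  by (simp add: smooth_on_def Ck_on_const)

lemma smooth_on_compose: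
  fixes g :: "'d::euclidean_space \<Rightarrow> 'f::real_normed_vector"
    and f :: "'e::euclidean_space \<Rightarrow> 'd"
  assumes "open S" "f ` S \<subseteq> T" "smooth_on T g" "smooth_on S f"
  shows "smooth_on S (\<lambda>x. g (f x))"
  using assms Ck_on_compose[of S f T _ g] by (simp add: smooth_on_def)

lemma smooth_on_sum:
  "open S \<Longrightarrow> (\<And>i. i \<in> I \<Longrightarrow> smooth_on S (f i)) \<Longrightarrow> smooth_on S (\<lambda>x. \<Sum>i\<in>I. f i x)"
  by (simp add: smooth_on_def Ck_on_sum)

lemma smooth_on_bounded_linear:
  "open S \<Longrightarrow> bounded_linear L \<Longrightarrow> smooth_on S f \<Longrightarrow> smooth_on S (\<lambda>x. L (f x))"
  by (simp add: smooth_on_def Ck_on_bounded_linear)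

lemma smooth_on_scaleR:
  "open S \<Longrightarrow> smooth_on S f \<Longrightarrow> smooth_on S g \<Longrightarrow> smooth_on S (\<lambda>x. f x *\<^sub>R g x)"
  by (simp add: smooth_on_def Ck_on_bounded_bilinear bounded_bilinear_scaleR)

lemma smooth_on_frechet_derivative:
  "smooth_on S f \<Longrightarrow> smooth_on S (\<lambda>x. frechet_derivative f (at x) v)"
  unfolding smooth_on_def using Ck_on.simps(2) by blast

lemma smooth_on_has_derivative:
  "smooth_on S f \<Longrightarrow> x \<in> S \<Longrightarrow> (f has_derivative frechet_derivative f (at x)) (at x)"
  unfolding smooth_on_def using Ck_on_has_derivative by blast

section \<open>Bump functions\<close>

lemma exp_inverse_divide_power_DERIV:
  fixes n :: nat
  defines "f \<equiv> \<lambda>n t. if 0 < t then exp (- 1 / t) / t ^ n else (0::real)"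
  shows "(f n has_real_derivative f (n + 2) t - real n * f (n + 1) t) (at t)"
proof -
  consider "t > 0" | "t < 0" | "t = 0" by linarith
  then show ?thesis
  proof cases
    case 1
    show ?thesis
    proof (rule has_field_derivative_transform_within_open[where S = "{0<..}"])
      have e: "((\<lambda>t. exp (- 1 / t)) has_real_derivative exp (- 1 / t) * (1 / t ^ 2)) (at t)"
        using 1 by (auto intro!: derivative_eq_intros simp: power2_eq_square)
      have p: "((\<lambda>t. inverse t ^ n) has_real_derivative
          real n * (- (inverse t ^ 2) * inverse t ^ (n - 1))) (at t)"
        using 1 DERIV_power[OF DERIV_inverse, of t n] by (simp add: numeral_2_eq_2)
      \<comment> \<open>The case split on \<open>n\<close> settles the truncated exponent
        \<open>n - 1\<close>: at \<open>n = 0\<close> its term is killed by the factor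
        \<open>real n\<close>.\<close>
      have "exp (- 1 / t) * (1 / t ^ 2) * inverse t ^ n
          + real n * (- (inverse t ^ 2) * inverse t ^ (n - 1)) * exp (- 1 / t)
          = f (n + 2) t - real n * f (n + 1) t"
        using 1 by (cases n) (auto simp: f_def field_simps power2_eq_square)
      then show "((\<lambda>t. exp (- 1 / t) * inverse t ^ n) has_real_derivative
          f (n + 2) t - real n * f (n + 1) t) (at t)"
        using DERIV_mult[OF e p] by simp
    qed (use 1 in \<open>auto simp: f_def field_simps\<close>)
  next
    case 2
    show ?thesis
      by (rule has_field_derivative_transform_within_open[where S = "{..<0}" and f = "\<lambda>_. 0"])
        (use 2 in \<open>auto simp: f_def\<close>)
  next
    case 3
    \<comment> \<open>The difference quotient of \<open>f n\<close> at 0 is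
      \<open>f (n + 1)\<close>, hence the raised exponent. Substituting \<open>inverse t\<close>
      reduces its right-hand limit to the decay of powers against the exponential.\<close>
    have "((\<lambda>t::real. inverse t ^ (n + 1) / exp (inverse t)) \<longlongrightarrow> 0) (at_right 0)"
      by (rule filterlim_compose[OF tendsto_power_div_exp_0 filterlim_inverse_at_top_right])
    moreover have "\<forall>\<^sub>F t in at_right 0. inverse t ^ (n + 1) / exp (inverse t) = f (n + 1) t"
      by (rule eventually_mono[OF eventually_at_right_less])
        (simp add: f_def exp_minus field_simps)
    ultimately have "((\<lambda>t. f (n + 1) t) \<longlongrightarrow> 0) (at_right 0)"
      by (rule Lim_transform_eventually)
    moreover have "((\<lambda>t. f (n + 1) t) \<longlongrightarrow> 0) (at_left 0)"
      by (rule Lim_transform_eventually[OF tendsto_const])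
        (auto simp: f_def eventually_at_filter)
    ultimately have "((\<lambda>t. f (n + 1) t) \<longlongrightarrow> 0) (at 0)"
      by (simp add: filterlim_split_at)
    moreover have "f (n + 1) t = (f n t - f n 0) / (t - 0)" for t
      by (simp add: f_def)
    ultimately show ?thesis
      using 3 by (simp add: has_field_derivative_iff f_def)
  qed
qed

text \<open>Differentiation yields linear combinations of the same functions with higher exponents,
  so one induction with \<open>n\<close> arbitrary gives every order. Only \<open>n = 0\<close> is
  wanted in the end.\<close>

lemma Ck_on_exp_inverse_divide_power:
  "Ck_on k UNIV (\<lambda>t. if 0 < t then exp (- 1 / t) / t ^ n else (0::real))"
proof (induction k arbitrary: n)
  case 0
  show ?case
    using exp_inverse_divide_power_DERIV
    by (auto intro: DERIV_isCont simp: continuous_on_eq_continuous_at)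
next
  case (Suc k)
  define f where "f = (\<lambda>n t. if 0 < t then exp (- 1 / t) / t ^ n else (0::real))"
  have "Ck_on (Suc k) UNIV (f n)"
  proof (rule Ck_on_SucI)
    show "(f n has_derivative (\<lambda>v. (f (n + 2) t - real n * f (n + 1) t) * v)) (at t)" for t
      using exp_inverse_divide_power_DERIV[of n t] unfolding f_def has_field_derivative_def .
    show "Ck_on k UNIV (\<lambda>t. (f (n + 2) t - real n * f (n + 1) t) * v)" for v
    proof -
      have "Ck_on k UNIV (\<lambda>t. (f (n + 2) t + (- real n) *\<^sub>R f (n + 1) t) * v)"
        using Suc.IH unfolding f_def
        by (intro Ck_on_bounded_linear[OF _ bounded_linear_mult_left] Ck_on_add
            Ck_on_bounded_linear[OF _ bounded_linear_scaleR_right]) auto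
      then show ?thesis by simp
    qed
  qed auto
  then show ?case by (simp add: f_def)
qed

text \<open>The flat function is composed with \<open>r ^ 2 - (x - a) \<bullet> (x - a)\<close>,
  which is positive exactly on the open ball.\<close>

lemma smooth_bump:
  fixes a :: "'e::euclidean_space"
  assumes "0 < r"
  obtains \<phi> :: "'e \<Rightarrow> real"
  where "\<And>S. open S \<Longrightarrow> smooth_on S \<phi>" "\<phi> a \<noteq> 0" "\<And>x. x \<notin> cball a r \<Longrightarrow> \<phi> x = 0"
proof -
  define g where "g t = (if 0 < t then exp (- 1 / t) / t ^ 0 else (0::real))" for t
  define q where "q x = r ^ 2 - (x - a) \<bullet> (x - a)" for x
  have g: "Ck_on k UNIV g" for k
    unfolding g_def by (rule Ck_on_exp_inverse_divide_power)
  have id: "Ck_on k UNIV (\<lambda>x::'e. x)" for k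
    by (cases k) (auto simp: frechet_derivative_ident Ck_on_const)
  have d: "Ck_on k UNIV (\<lambda>x. x + - a)" for k
    by (intro Ck_on_add id Ck_on_const open_UNIV)
  have "Ck_on k UNIV (\<lambda>x. r ^ 2 + - ((x + - a) \<bullet> (x + - a)))" for k
    by (intro Ck_on_add Ck_on_const d open_UNIV Ck_on_bounded_bilinear[OF _ bounded_bilinear_inner]
        Ck_on_bounded_linear[OF _ bounded_linear_minus[OF bounded_linear_ident]])
  then have "Ck_on k UNIV q" for k
    by (simp add: q_def[abs_def])
  then have "Ck_on k UNIV (\<lambda>x. g (q x))" for k
    by (intro Ck_on_compose[OF _ _ g]) auto
  then have "smooth_on S (\<lambda>x. g (q x))" for S
    unfolding smooth_on_def by (blast intro: Ck_on_subset)
  moreover have "g (q a) \<noteq> 0"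
    using assms by (simp add: g_def q_def)
  moreover have "g (q x) = 0" if "x \<notin> cball a r" for x
  proof -
    have "r ^ 2 \<le> norm (x - a) ^ 2"
      using that assms by (intro power_mono) (auto simp: dist_norm norm_minus_commute)
    then show ?thesis
      by (simp add: g_def q_def power2_norm_eq_inner)
  qed
  ultimately show thesis
    using that by blast
qed

section \<open>Charts and smooth sections\<close>

text \<open>The Jacobian of the change from \<open>c\<close> to \<open>d\<close>. Both
  \<open>to_chart\<close> and \<open>from_chart\<close> are instances, with the selected chart as
  source and as target, so identities for transitions serve both.\<close>

definition transition :: "('m, 'e::euclidean_space) chart \<Rightarrow> ('m, 'e) chart \<Rightarrow> 'm \<Rightarrow> 'e \<Rightarrow> 'e" where
  "transition c d p = frechet_derivative (snd d \<circ> chart_inv c) (at (snd c p))"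

locale atlas =
  fixes A :: "('m::{t2_space, second_countable_topology}, 'e::euclidean_space) chart set"
  assumes manifold: "smooth_manifold A"
begin

lemma
  assumes "c \<in> A"
  shows open_chart: "open (fst c)"
    and open_chart_image: "open (chart_image c)"
    and chart_homeomorphism: "homeomorphism (fst c) (chart_image c) (snd c) (chart_inv c)"
  using manifold assms by (auto simp: smooth_manifold_def)

lemma
  assumes "c \<in> A"
  shows chart_inv_chart: "p \<in> fst c \<Longrightarrow> chart_inv c (snd c p) = p"
    and chart_chart_inv: "x \<in> chart_image c \<Longrightarrow> snd c (chart_inv c x) = x"
    and chart_inv_mem: "x \<in> chart_image c \<Longrightarrow> chart_inv c x \<in> fst c"
    and chart_mem: "p \<in> fst c \<Longrightarrow> snd c p \<in> chart_image c"
  using chart_homeomorphism[OF assms] unfolding homeomorphism_def by auto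

lemma open_image_chart:
  assumes "c \<in> A" "open U"
  shows "open (snd c ` (fst c \<inter> U))"
proof -
  have "openin (top_of_set (chart_image c)) (snd c ` (fst c \<inter> U))"
    using assms by (intro homeomorphism_imp_open_map[OF chart_homeomorphism]) (auto intro: openin_open_Int)
  then show ?thesis
    using open_chart_image[OF assms(1)] openin_open_trans by blast
qed

lemma
  shows chart_at_atlas: "chart_at A p \<in> A" and chart_at_mem: "p \<in> fst (chart_at A p)"
proof -
  have "\<exists>c. c \<in> A \<and> p \<in> fst c"
    using manifold UNIV_I[of p] unfolding smooth_manifold_def by blast
  then show "chart_at A p \<in> A" "p \<in> fst (chart_at A p)"
    unfolding chart_at_def by (metis (mono_tags, lifting) someI_ex)+
qed

lemma smooth_on_transition:
  "c \<in> A \<Longrightarrow> d \<in> A \<Longrightarrow> smooth_on (snd c ` (fst c \<inter> fst d)) (snd d \<circ> chart_inv c)"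
  using manifold by (simp add: smooth_manifold_def)

lemma transition_has_derivative:
  assumes "c \<in> A" "d \<in> A" "p \<in> fst c" "p \<in> fst d"
  shows "(snd d \<circ> chart_inv c has_derivative transition c d p) (at (snd c p))"
  unfolding transition_def
  by (rule smooth_on_has_derivative[OF smooth_on_transition[OF assms(1,2)]]) (use assms in blast)

lemma linear_transition:
  "c \<in> A \<Longrightarrow> d \<in> A \<Longrightarrow> p \<in> fst c \<Longrightarrow> p \<in> fst d \<Longrightarrow> linear (transition c d p)"
  using has_derivative_linear[OF transition_has_derivative] .

text \<open>The cocycle identity is the chain rule. The composite coordinate change equals the
  direct one on the image in \<open>c\<close> of its overlap with \<open>d\<close>, an open set
  containing the base point, so the derivatives there agree.\<close>

lemma transition_transition:
  assumes "c \<in> A" "d \<in> A" "e \<in> A" "p \<in> fst c" "p \<in> fst d" "p \<in> fst e"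
  shows "transition d e p (transition c d p v) = transition c e p v"
proof -
  have "(snd d \<circ> chart_inv c) (snd c p) = snd d p"
    using assms by (simp add: chart_inv_chart)
  then have "((snd e \<circ> chart_inv d) \<circ> (snd d \<circ> chart_inv c) has_derivative
      transition d e p \<circ> transition c d p) (at (snd c p))"
    using assms by (intro diff_chain_at) (simp_all only: transition_has_derivative)
  then have "(snd e \<circ> chart_inv c has_derivative transition d e p \<circ> transition c d p)
      (at (snd c p))"
    by (rule has_derivative_transform_within_open[OF _ open_image_chart[OF assms(1) open_chart[OF assms(2)]]])
      (use assms in \<open>auto simp: chart_inv_chart\<close>)
  then have "transition d e p \<circ> transition c d p = transition c e p"
    using transition_has_derivative[OF assms(1,3,4,6)] by (rule has_derivative_unique)
  then show ?thesis
    by (metis comp_apply)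
qed

lemma transition_same:
  assumes "c \<in> A" "p \<in> fst c"
  shows "transition c c p v = v"
proof -
  have "(snd c \<circ> chart_inv c has_derivative (\<lambda>v. v)) (at (snd c p))"
    by (rule has_derivative_transform_within_open[OF has_derivative_ident open_chart_image[OF assms(1)]])
      (use assms in \<open>auto simp: chart_chart_inv chart_mem\<close>)
  from has_derivative_unique[OF transition_has_derivative[OF assms(1,1,2,2)] this]
  show ?thesis by simp
qed

lemma
  assumes "c \<in> A" "p \<in> fst c"
  shows linear_to_chart: "linear (to_chart A c p)"
    and linear_from_chart: "linear (from_chart A c p)"
    and to_chart_from_chart: "to_chart A c p (from_chart A c p v) = v"
    and from_chart_to_chart: "from_chart A c p (to_chart A c p v) = v"
    and to_chart_from_chart_transition:
      "d \<in> A \<Longrightarrow> p \<in> fst d \<Longrightarrow> to_chart A d p (from_chart A c p v) = transition c d p v"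
  unfolding to_chart_def from_chart_def transition_def[symmetric]
  using assms linear_transition transition_transition transition_same chart_at_atlas chart_at_mem
  by metis+

text \<open>A field with constant components in a chart is cut off by a bump function and extended
  by zero. Such fields later test identities at a single point.\<close>

lemma smooth_vfield_through:
  obtains X where "smooth_vfield A X" "X p = v"
proof -
  define c where "c = chart_at A p"
  have c: "c \<in> A" "p \<in> fst c"
    by (simp_all add: c_def chart_at_atlas chart_at_mem)
  obtain r where r: "r > 0" "cball (snd c p) r \<subseteq> chart_image c"
    using open_contains_cball open_chart_image[OF c(1)] chart_mem[OF c] by blast
  obtain \<phi> :: "'e \<Rightarrow> real" where \<phi>: "\<And>S. open S \<Longrightarrow> smooth_on S \<phi>" "\<phi> (snd c p) \<noteq> 0"
    "\<And>x. x \<notin> cball (snd c p) r \<Longrightarrow> \<phi> x = 0"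
    using smooth_bump[OF r(1), of "snd c p"] by blast
  \<comment> \<open>The factor compensates the value of the bump function at \<open>p\<close>, so
    that the field takes the value \<open>v\<close> there.\<close>
  define u where "u = (1 / \<phi> (snd c p)) *\<^sub>R to_chart A c p v"
  define X where "X q = (if q \<in> fst c then \<phi> (snd c q) *\<^sub>R from_chart A c q u else 0)" for q
  define K where "K = chart_inv c ` cball (snd c p) r"
  have "compact K"
    unfolding K_def using chart_homeomorphism[OF c(1)] r(2)
    by (intro compact_continuous_image) (auto simp: homeomorphism_def intro: continuous_on_subset)
  \<comment> \<open>The Hausdorff property enters here: the compact set \<open>K\<close> is closed
    in the manifold, so the extension by zero vanishes near every point outside the chart
    domain.\<close>
  then have "open (- K)"
    using compact_imp_closed by blast
  have "K \<subseteq> fst c"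
    using r(2) chart_inv_mem[OF c(1)] by (auto simp: K_def)
  have X_out: "X q = 0" if "q \<notin> K" for q
  proof (cases "q \<in> fst c")
    case True
    then have "snd c q \<notin> cball (snd c p) r"
      using that chart_inv_chart[OF c(1) True] by (force simp: K_def)
    then show ?thesis by (simp add: X_def \<phi>(3))
  qed (simp add: X_def)
  have "smooth_vfield A X"
    unfolding smooth_vfield_def
  proof (intro ballI smooth_on_local)
    fix d x
    assume d: "d \<in> A" and x: "x \<in> chart_image d"
    define q where "q = chart_inv d x"
    have q: "q \<in> fst d" "snd d q = x"
      using d x by (simp_all add: q_def chart_inv_mem chart_chart_inv)
    let ?G = "\<lambda>y. to_chart A d (chart_inv d y) (X (chart_inv d y))"
    show "\<exists>U. open U \<and> x \<in> U \<and> smooth_on U ?G"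
    proof (cases "q \<in> fst c")
      case True
      define U where "U = snd d ` (fst d \<inter> fst c)"
      have U: "open U" "x \<in> U"
        using open_image_chart[OF d open_chart[OF c(1)]] True q by (auto simp: U_def)
      have eq: "\<phi> (snd c (chart_inv d y)) *\<^sub>R
          frechet_derivative (snd d \<circ> chart_inv c) (at (snd c (chart_inv d y))) u = ?G y"
        if "y \<in> U" for y
      proof -
        have "chart_inv d y \<in> fst d" "chart_inv d y \<in> fst c"
          using that chart_inv_chart[OF d] by (auto simp: U_def)
        then show ?thesis
          using c d by (simp add: X_def linear_scale[OF linear_to_chart]
              to_chart_from_chart_transition transition_def)
      qed
      have "smooth_on U (\<lambda>y. snd c (chart_inv d y))"
        using smooth_on_transition[OF d c(1)] by (simp add: U_def o_def)
      moreover have "(\<lambda>y. snd c (chart_inv d y)) ` U \<subseteq> snd c ` (fst c \<inter> fst d)"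
        using chart_inv_chart[OF d] by (auto simp: U_def)
      ultimately have smooth: "smooth_on U (\<lambda>y. \<phi> (snd c (chart_inv d y)) *\<^sub>R
          frechet_derivative (snd d \<circ> chart_inv c) (at (snd c (chart_inv d y))) u)"
        using U(1)
        by (intro smooth_on_scaleR
            smooth_on_compose[OF _ _ smooth_on_frechet_derivative[OF smooth_on_transition[OF c(1) d]]]
            smooth_on_compose[OF _ subset_UNIV \<phi>(1)[OF open_UNIV]]) auto
      show ?thesis
        by (intro exI[of _ U] conjI smooth_on_cong[OF U(1) eq smooth] U)
    next
      case False
      define U where "U = snd d ` (fst d \<inter> - K)"
      have U: "open U" "x \<in> U"
        using open_image_chart[OF d \<open>open (- K)\<close>] False q \<open>K \<subseteq> fst c\<close> by (auto simp: U_def)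
      have eq: "0 = ?G y" if "y \<in> U" for y
      proof -
        have "chart_inv d y \<in> fst d" "chart_inv d y \<notin> K"
          using that chart_inv_chart[OF d] by (auto simp: U_def)
        then show ?thesis
          using X_out linear_0[OF linear_to_chart[OF d]] by simp
      qed
      show ?thesis
        by (intro exI[of _ U] conjI smooth_on_cong[OF U(1) eq smooth_on_const] U)
    qed
  qed
  moreover have "X p = v"
    using c \<phi>(2) by (simp add: X_def u_def linear_scale[OF linear_from_chart] from_chart_to_chart)
  ultimately show thesis by (rule that)
qed

text \<open>In a chart, the tensor with its second argument fixed is a smooth family of linear maps,
  evaluated at the moving components of \<open>X\<close>.\<close>

lemma smooth_oneform_tensor:
  assumes "smooth_tensor02 A h" "smooth_vfield A X"
  shows "smooth_oneform A (\<lambda>p. h p (X p))"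
  unfolding smooth_oneform_def
proof (intro ballI allI)
  fix c u
  assume c: "c \<in> A"
  let ?q = "chart_inv c"
  let ?H = "\<lambda>x w. h (?q x) (from_chart A c (?q x) w) (from_chart A c (?q x) u)"
  let ?z = "\<lambda>x. to_chart A c (?q x) (X (?q x))"
  have lin: "linear (?H x)" if "x \<in> chart_image c" for x
    using linear_from_chart[OF c chart_inv_mem[OF c that]]
    by (auto intro!: linearI simp: linear_add linear_scale blinfun.bilinear_simps)
  have "smooth_on (chart_image c) (\<lambda>x. ?H x (?z x))"
  proof (rule smooth_on_linear_family[where H = ?H and z = ?z])
    show "open (chart_image c)"
      using c by (rule open_chart_image)
    show "linear (?H x)" if "x \<in> chart_image c" for x
      using that by (rule lin)
    show "smooth_on (chart_image c) (\<lambda>x. ?H x w)" for w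
      using assms(1) c by (simp add: smooth_tensor02_def)
    show "smooth_on (chart_image c) ?z"
      using assms(2) c by (simp add: smooth_vfield_def)
  qed
  then show "smooth_on (chart_image c) (\<lambda>x. h (?q x) (X (?q x)) (from_chart A c (?q x) u))"
    by (rule smooth_on_cong[OF open_chart_image[OF c], rotated])
      (simp add: from_chart_to_chart c chart_inv_mem)
qed

text \<open>In a chart, the components of the field solve the linear system given by the matrix of
  \<open>h\<close>, with the components of the 1-form on the right; solutions of such systems are
  smooth.\<close>

lemma smooth_vfield_h_inv:
  assumes "smooth_tensor02 A h" "\<And>p. bij (blinfun_apply (h p))" "smooth_oneform A \<beta>"
  shows "smooth_vfield A (\<lambda>p. h_inv h p (\<beta> p))"
  unfolding smooth_vfield_def
proof
  fix c
  assume c: "c \<in> A"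
  let ?S = "chart_image c"
  let ?q = "chart_inv c"
  let ?f = "\<lambda>x. from_chart A c (?q x)"
  \<comment> \<open>Functionals are replaced by the vectors of their values on the coordinate basis,
    which makes the system a family of endomorphisms of \<open>'e\<close>.\<close>
  let ?H = "\<lambda>x w. \<Sum>b\<in>Basis. h (?q x) (?f x w) (?f x b) *\<^sub>R b"
  let ?z = "\<lambda>x. to_chart A c (?q x) (h_inv h (?q x) (\<beta> (?q x)))"
  have lin_f: "linear (?f x)" if "x \<in> ?S" for x
    using linear_from_chart[OF c chart_inv_mem[OF c that]] .
  have lin: "linear (?H x)" if "x \<in> ?S" for x
    using lin_f[OF that]
    by (auto intro!: linearI simp: linear_add linear_scale blinfun.bilinear_simps
        scaleR_left_distrib sum.distrib scaleR_sum_right)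
  have inj: "inj (?H x)" if x: "x \<in> ?S" for x
    unfolding linear_injective_0[OF lin[OF x]]
  proof (intro allI impI)
    fix w
    assume "?H x w = 0"
    then have "h (?q x) (?f x w) (?f x b) = 0" if "b \<in> Basis" for b
      using inner_sum_left_Basis[OF that, of "\<lambda>b. h (?q x) (?f x w) (?f x b)"] by simp
    then have "linear (\<lambda>v. h (?q x) (?f x w) (?f x v))"
      "\<And>b. b \<in> Basis \<Longrightarrow> h (?q x) (?f x w) (?f x b) = 0"
      using lin_f[OF x]
      by (auto intro!: linearI simp: linear_add linear_scale blinfun.bilinear_simps)
    then have "h (?q x) (?f x w) (?f x v) = 0" for v
      using linear_basis_sum[of "\<lambda>v. h (?q x) (?f x w) (?f x v)" v] by simp
    then have "h (?q x) (?f x w) v = 0" for v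
      using from_chart_to_chart[OF c chart_inv_mem[OF c x]] by metis
    then have "h (?q x) (?f x w) = h (?q x) 0"
      by (intro blinfun_eqI) (simp add: blinfun.bilinear_simps)
    then have "?f x w = 0"
      using assms(2) by (metis bij_is_inj injD)
    then show "w = 0"
      using to_chart_from_chart[OF c chart_inv_mem[OF c x]]
        linear_0[OF linear_to_chart[OF c chart_inv_mem[OF c x]]] by metis
  qed
  have smooth_H: "smooth_on ?S (\<lambda>x. ?H x w)" for w
    using assms(1) c unfolding smooth_tensor02_def
    by (intro smooth_on_sum smooth_on_bounded_linear[OF _ bounded_linear_scaleR_left]
        open_chart_image) auto
  have smooth_Hz: "smooth_on ?S (\<lambda>x. ?H x (?z x))"
  proof (rule smooth_on_cong[OF open_chart_image[OF c]])
    show "smooth_on ?S (\<lambda>x. \<Sum>b\<in>Basis. \<beta> (?q x) (?f x b) *\<^sub>R b)"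
      using assms(3) c unfolding smooth_oneform_def
      by (intro smooth_on_sum smooth_on_bounded_linear[OF _ bounded_linear_scaleR_left]
          open_chart_image) auto
    show "(\<Sum>b\<in>Basis. \<beta> (?q x) (?f x b) *\<^sub>R b) = ?H x (?z x)" if "x \<in> ?S" for x
      using that assms(2)
      by (simp add: from_chart_to_chart[OF c chart_inv_mem[OF c]] h_inv_def bij_is_surj surj_f_inv_f)
  qed
  show "smooth_on ?S ?z"
    by (rule smooth_on_linear_family_solution[where H = ?H, OF open_chart_image[OF c]])
      (rule lin inj smooth_H smooth_Hz, assumption?)+
qed

end

section \<open>The structures on the generalized tangent bundle\<close>

text \<open>Non-degeneracy gives injectivity; surjectivity is a dimension count. The map
  \<open>f\<close> records functionals by their values on \<open>Basis\<close> and is thus an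
  injective endomorphism of \<open>'e\<close>, hence onto.\<close>

lemma bij_nondegenerate_tensor:
  assumes "nondegenerate_tensor h"
  shows "bij (blinfun_apply (h p))"
proof -
  have inj: "inj (blinfun_apply (h p))"
    using assms blinfun.bounded_linear_right[of "h p"]
    by (simp add: linear_injective_0 bounded_linear.linear nondegenerate_tensor_def)
      (metis blinfun.zero_left)
  define f where "f v = (\<Sum>b\<in>Basis. h p v b *\<^sub>R b)" for v
  have coord: "f v \<bullet> b = h p v b" if "b \<in> Basis" for v b
    using inner_sum_left_Basis[OF that, of "\<lambda>b. h p v b"] by (simp add: f_def)
  have lin: "linear f"
    unfolding f_def
    by (auto intro!: linearI
        simp: blinfun.bilinear_simps scaleR_left_distrib sum.distrib scaleR_sum_right)
  have "inj f"
  proof (rule injI)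
    fix v w assume "f v = f w"
    then have "h p v = h p w"
      by (metis blinfun_euclidean_eqI coord)
    then show "v = w" using inj by (simp add: inj_eq)
  qed
  then have surj: "surj f"
    using lin linear_injective_imp_surjective by blast
  have "\<exists>v. \<beta> = h p v" for \<beta>
  proof -
    obtain v where v: "f v = (\<Sum>b\<in>Basis. \<beta> b *\<^sub>R b)"
      using surj by (metis surjD)
    have "\<beta> b = h p v b" if "b \<in> Basis" for b
      using coord[OF that, of v] inner_sum_left_Basis[OF that, of "\<lambda>b. \<beta> b"] by (simp add: v)
    then show ?thesis
      by (metis blinfun_euclidean_eqI)
  qed
  then show ?thesis
    using inj by (auto simp: bij_def)
qed

lemma
  assumes "nondegenerate_tensor h"
  shows h_inv_h: "h_inv h p (h p v) = v" and h_h_inv: "h p (h_inv h p \<beta>) = \<beta>"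
  using bij_nondegenerate_tensor[OF assms, of p]
  by (simp_all add: h_inv_def bij_is_inj bij_is_surj surj_f_inv_f)

context atlas
begin

lemma smooth_vfield_scaleR:
  assumes "smooth_vfield A X"
  shows "smooth_vfield A (\<lambda>p. s *\<^sub>R X p)"
  unfolding smooth_vfield_def
proof
  fix c
  assume c: "c \<in> A"
  show "smooth_on (chart_image c) (\<lambda>x. to_chart A c (chart_inv c x) (s *\<^sub>R X (chart_inv c x)))"
  proof (rule smooth_on_cong[OF open_chart_image[OF c]])
    show "smooth_on (chart_image c) (\<lambda>x. s *\<^sub>R to_chart A c (chart_inv c x) (X (chart_inv c x)))"
      using assms c
      by (intro smooth_on_bounded_linear[OF _ bounded_linear_scaleR_right] open_chart_image)
        (simp_all add: smooth_vfield_def)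
  qed (simp add: linear_scale[OF linear_to_chart[OF c chart_inv_mem[OF c]]])
qed

text \<open>The Leibniz rule for a constant function, whose derivative along \<open>X\<close>
  vanishes.\<close>

lemma affine_connection_scaleR:
  assumes "affine_connection A nab" "smooth_vfield A X" "smooth_vfield A Y"
  shows "nab X (\<lambda>p. s *\<^sub>R Y p) = (\<lambda>p. s *\<^sub>R nab X Y p)"
proof -
  have "smooth_function A (\<lambda>_. s)"
    by (simp add: smooth_function_def o_def smooth_on_const)
  moreover have "deriv_along A X (\<lambda>_. s) p = 0" for p
    by (simp add: deriv_along_def o_def frechet_derivative_const)
  moreover have "\<forall>f X Y. smooth_function A f \<longrightarrow> smooth_vfield A X \<longrightarrow> smooth_vfield A Y \<longrightarrow>
      nab X (\<lambda>p. f p *\<^sub>R Y p) = (\<lambda>p. f p *\<^sub>R nab X Y p + deriv_along A X f p *\<^sub>R Y p)"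
    using assms(1) unfolding affine_connection_def by blast
  ultimately show ?thesis
    using assms(2,3) by simp
qed

end

text \<open>A common form of \<open>J_c\<close> (\<open>s = -1\<close>) and \<open>J_p\<close> (\<open>s = 1\<close>).\<close>

definition J_scaled ::
    "real \<Rightarrow> ('m, 'e::euclidean_space) tensor02 \<Rightarrow> 'm \<Rightarrow> 'e gfibre \<Rightarrow> 'e gfibre" where
  "J_scaled s h p \<tau> = (s *\<^sub>R h_inv h p (snd \<tau>), h p (fst \<tau>))"

lemma J_c_eq: "J_c h = J_scaled (- 1) h" and J_p_eq: "J_p h = J_scaled 1 h"
  by (auto simp: J_c_def J_p_def J_scaled_def fun_eq_iff)

text \<open>With the covectors written as \<open>h p a\<close> and \<open>h p b\<close>, both sides
  equal \<open>- (1/2) * (s * h p a b + h p x y)\<close>. In the skew case the minus sign in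
  \<open>hat_h\<close> absorbs the one from exchanging the arguments of \<open>h\<close>.\<close>

lemma hat_h_J_scaled:
  assumes "nondegenerate_tensor h" "symmetric_tensor h \<or> skew_symmetric_tensor h"
  shows "hat_h h p \<tau> (J_scaled s h p \<nu>) = hat_h h p (J_scaled s h p \<tau>) \<nu>"
proof -
  obtain x a where \<tau>: "\<tau> = (x, h p a)"
    by (metis h_h_inv[OF assms(1)] prod.collapse)
  obtain y b where \<nu>: "\<nu> = (y, h p b)"
    by (metis h_h_inv[OF assms(1)] prod.collapse)
  show ?thesis
  proof (cases "symmetric_tensor h")
    case True
    then have "h p y x = h p x y" "h p b a = h p a b"
      by (simp_all add: symmetric_tensor_def)
    then show ?thesis
      using True
      by (simp add: hat_h_def J_scaled_def \<tau> \<nu> h_inv_h[OF assms(1)] blinfun.bilinear_simps)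
  next
    case False
    then have "h p y x = - h p x y" "h p b a = - h p a b"
      using assms(2) unfolding skew_symmetric_tensor_def by blast+
    then show ?thesis
      using False
      by (simp add: hat_h_def J_scaled_def \<tau> \<nu> h_inv_h[OF assms(1)] blinfun.bilinear_simps)
  qed
qed

section \<open>Parallelism for the lifted and the dual connection\<close>

context atlas
begin

text \<open>Vector fields through \<open>p\<close> with zero form part detect the covector
  component; their images under \<open>h\<close> detect the vector component.\<close>

lemma hat_h_separates:
  assumes "smooth_tensor02 A h" "nondegenerate_tensor h"
    and "symmetric_tensor h \<or> skew_symmetric_tensor h"
    and eq: "\<And>\<tau>. smooth_gsection A \<tau> \<Longrightarrow> hat_h h p (\<tau> p) \<mu> = hat_h h p (\<tau> p) \<nu>"
  shows "\<mu> = \<nu>"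
proof -
  have "snd \<mu> v = snd \<nu> v \<and> h p v (fst \<mu>) = h p v (fst \<nu>)" for v
  proof -
    obtain X where X: "smooth_vfield A X" "X p = v"
      using smooth_vfield_through by blast
    have "smooth_vfield A (\<lambda>_. 0)" "smooth_oneform A (\<lambda>_. 0)"
      using smooth_vfield_scaleR[OF X(1), of 0] by (simp_all add: smooth_oneform_def smooth_on_const)
    then have "smooth_gsection A (\<lambda>q. (X q, 0))" "smooth_gsection A (\<lambda>q. (0, h q (X q)))"
      using X(1) smooth_oneform_tensor[OF assms(1) X(1)] by (simp_all add: smooth_gsection_def o_def)
    from eq[OF this(1)] eq[OF this(2)] show ?thesis
      by (simp add: hat_h_def X(2) split: if_splits)
  qed
  then have "snd \<mu> = snd \<nu>" and *: "h p v (fst \<mu>) = h p v (fst \<nu>)" for v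
    by (auto intro: blinfun_eqI)
  \<comment> \<open>So far the vector parts occur as second arguments of \<open>h\<close>; symmetry
    or skew-symmetry moves them to the first, where \<open>h_inv\<close> applies.\<close>
  have "h p (fst \<mu>) = h p (fst \<nu>)"
    using * assms(3) unfolding symmetric_tensor_def skew_symmetric_tensor_def
    by (metis blinfun_eqI)
  then have "fst \<mu> = fst \<nu>"
    using h_inv_h[OF assms(2)] by metis
  then show ?thesis
    using \<open>snd \<mu> = snd \<nu>\<close> by (simp add: prod_eq_iff)
qed

text \<open>The dual connection is specified on smooth sections only, so its equation can be used at
  \<open>J \<tau>\<close> and \<open>J \<nu>\<close> only after this.\<close>

lemma smooth_gsection_J_scaled:
  assumes "smooth_tensor02 A h" "nondegenerate_tensor h" "smooth_gsection A \<tau>"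
  shows "smooth_gsection A (\<lambda>p. J_scaled s h p (\<tau> p))"
proof -
  have "smooth_vfield A (\<lambda>p. s *\<^sub>R h_inv h p (snd (\<tau> p)))"
    using assms(3) unfolding smooth_gsection_def o_def
    by (intro smooth_vfield_scaleR smooth_vfield_h_inv[OF assms(1)] bij_nondegenerate_tensor[OF assms(2)])
      simp
  moreover have "smooth_oneform A (\<lambda>p. h p (fst (\<tau> p)))"
    using assms(3) unfolding smooth_gsection_def o_def
    by (intro smooth_oneform_tensor[OF assms(1)]) simp
  ultimately show ?thesis
    by (simp add: smooth_gsection_def o_def J_scaled_def)
qed

text \<open>In the form component \<open>h_inv\<close> cancels \<open>h\<close> inside the lifted
  connection. In the vector component the constant \<open>s\<close> passes through
  \<open>nab\<close>.\<close>

lemma parallel_hat_nabla_J_scaled: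
  assumes "smooth_tensor02 A h" "nondegenerate_tensor h" "affine_connection A nab"
  shows "parallel A (hat_nabla h nab) (J_scaled s h)"
  unfolding parallel_def
proof (intro allI impI)
  fix \<sigma> \<tau>
  assume \<sigma>: "smooth_gsection A \<sigma>" and \<tau>: "smooth_gsection A \<tau>"
  have "smooth_vfield A (\<lambda>p. h_inv h p (snd (\<tau> p)))"
    using smooth_vfield_h_inv[OF assms(1) bij_nondegenerate_tensor[OF assms(2)]] \<tau>
    by (simp add: smooth_gsection_def o_def)
  then have "nab (fst \<circ> \<sigma>) (\<lambda>p. s *\<^sub>R h_inv h p (snd (\<tau> p)))
      = (\<lambda>p. s *\<^sub>R nab (fst \<circ> \<sigma>) (\<lambda>p. h_inv h p (snd (\<tau> p))) p)"
    using affine_connection_scaleR[OF assms(3)] \<sigma> by (simp add: smooth_gsection_def)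
  then show "hat_nabla h nab \<sigma> (\<lambda>p. J_scaled s h p (\<tau> p))
      = (\<lambda>p. J_scaled s h p (hat_nabla h nab \<sigma> \<tau> p))"
    by (simp add: hat_nabla_def J_scaled_def o_def h_inv_h[OF assms(2)])
qed

text \<open>Writing \<open>g\<close> for \<open>hat_h\<close> and \<open>X\<close> for the vector
  part of \<open>\<sigma>\<close>: \<open>g(\<tau>, D' (J \<nu>)) = X g(\<tau>, J \<nu>) - g(D
  \<tau>, J \<nu>) = X g(J \<tau>, \<nu>) - g(D (J \<tau>), \<nu>) = g(J \<tau>, D' \<nu>) =
  g(\<tau>, J (D' \<nu>))\<close>.\<close>

lemma parallel_dual_connection:
  assumes "smooth_tensor02 A h" "nondegenerate_tensor h"
    and "symmetric_tensor h \<or> skew_symmetric_tensor h"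
    and dual: "dual_connection A (hat_h h) D D'"
    and parallel: "parallel A D J"
    and smooth: "\<And>\<tau>. smooth_gsection A \<tau> \<Longrightarrow> smooth_gsection A (\<lambda>p. J p (\<tau> p))"
    and adjoint: "\<And>p \<tau> \<nu>. hat_h h p \<tau> (J p \<nu>) = hat_h h p (J p \<tau>) \<nu>"
  shows "parallel A D' J"
  unfolding parallel_def
proof (intro allI impI ext)
  fix \<sigma> \<nu> p
  assume \<sigma>: "smooth_gsection A \<sigma>" and \<nu>: "smooth_gsection A \<nu>"
  show "D' \<sigma> (\<lambda>p. J p (\<nu> p)) p = J p (D' \<sigma> \<nu> p)"
  proof (rule hat_h_separates[OF assms(1-3)])
    fix \<tau>
    assume \<tau>: "smooth_gsection A \<tau>"
    have D': "hat_h h p (\<tau> p) (D' \<sigma> \<nu> p) =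
        deriv_along A (fst \<circ> \<sigma>) (\<lambda>q. hat_h h q (\<tau> q) (\<nu> q)) p - hat_h h p (D \<sigma> \<tau> p) (\<nu> p)"
      if "smooth_gsection A \<nu>" "smooth_gsection A \<tau>" for \<nu> \<tau>
      using dual that \<sigma> by (simp add: dual_connection_def)
    have "D \<sigma> (\<lambda>p. J p (\<tau> p)) p = J p (D \<sigma> \<tau> p)"
      using parallel \<sigma> \<tau> by (simp add: parallel_def)
    then show "hat_h h p (\<tau> p) (D' \<sigma> (\<lambda>p. J p (\<nu> p)) p) = hat_h h p (\<tau> p) (J p (D' \<sigma> \<nu> p))"
      using D'[OF smooth[OF \<nu>] \<tau>] D'[OF \<nu> smooth[OF \<tau>]] by (simp add: adjoint)
  qed
qed

end

theorem proposition3p9: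
  fixes A :: "('m::{t2_space, second_countable_topology}, 'e::euclidean_space) chart set"
    and h :: "('m, 'e) tensor02"
    and nab :: "('m, 'e) vfield \<Rightarrow> ('m, 'e) vfield \<Rightarrow> ('m, 'e) vfield"
    and hat_nabla_dual :: "('m, 'e) gsection \<Rightarrow> ('m, 'e) gsection \<Rightarrow> ('m, 'e) gsection"
  assumes "smooth_manifold A"
    and "smooth_tensor02 A h"
    and "nondegenerate_tensor h"
    and "symmetric_tensor h \<or> skew_symmetric_tensor h"
    and "affine_connection A nab"
    and "quasi_statistical A h nab"
    and "dual_connection A (hat_h h) (hat_nabla h nab) hat_nabla_dual"
  shows "parallel A (hat_nabla h nab) (J_c h) \<and>
         parallel A (hat_nabla h nab) (J_p h) \<and>
         parallel A hat_nabla_dual (J_c h) \<and>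
         parallel A hat_nabla_dual (J_p h)"
proof -
  interpret atlas A
    using assms(1) by unfold_locales
  have nabla: "parallel A (hat_nabla h nab) (J_scaled s h)" for s
    using assms(2,3,5) by (rule parallel_hat_nabla_J_scaled)
  moreover have "parallel A hat_nabla_dual (J_scaled s h)" for s
    by (rule parallel_dual_connection[OF assms(2-4,7) nabla])
      (simp_all add: smooth_gsection_J_scaled hat_h_J_scaled assms)
  ultimately show ?thesis
    by (simp add: J_c_eq J_p_eq)
qed

end
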